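(* Let $d\ge2$, $k>0$, and let $N_k$ be the Newton kernel of the rank one Dunkl Laplacian in $\mathbb{R}^d$. Put $\Phi(x,y):=|x-y|\vee|x-\sigma y|$. Then, for $x,y\in\mathbb{R}^d$, with constants in $\asymp$ depending only on $d$ and $k$: 1. If $d=2$, then $$N_k(x,y)\asymp\frac{1}{\Phi(x,y)^{2k}}\left[1\vee\log\left(\frac{|x_1y_1|}{|x-y|^2}\right)\right].$$ 2. If $d=3$, then $$N_k(x,y)\asymp\frac{1}{\Phi(x,y)^{2k}|x-y|}.$$ 3. If $d=4$, then $$N_k(x,y)\asymp\frac{1}{\Phi(x,y)^{2k}|x-y|^2}\left[1\vee\log\left(\frac{|x_1y_1|}{|x-\sigma y|^2}\right)\right].$$ 4. If $d\ge5$, then $$N_k(x,y)\asymp\frac{1}{\Phi(x,y)^{2k}|x-y|^2\,(|x-y|\wedge|x-\sigma y|)^{d-4}}.$$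
   Context: Rank one setting: $x=(x_1,\dots,x_d)$ are coordinates in an orthonormal basis of $\mathbb{R}^d$ such that the root system is $\{\pm\alpha\}$ with $\alpha=(\sqrt2,0,\dots,0)$, the reflection is $\sigma(x_1,x_2,\dots,x_d)=(-x_1,x_2,\dots,x_d)$, and the multiplicity is a number $k>0$ (so $\gamma=k$ and $d+2k>2$). The Newton kernel is $$N_k(x,y)=c_kC_k\int_{-1}^1\frac{(1-t)^{k-1}(1+t)^k\,dt}{\bigl(|x|^2+|y|^2-2(tx_1y_1+x_2y_2+\dots+x_dy_d)\bigr)^{k+d/2-1}}\in[0,\infty],$$ where $c_k=\frac{\Gamma(k+1/2)}{\sqrt\pi\,\Gamma(k)}$, $C_k=\frac{1}{d_k(d+2k-2)}$, $d_k=\int_{\mathbb{S}}|\langle\alpha,x\rangle|^{2k}dS(x)$, $\mathbb{S}$ being the unit sphere with surface measure $dS$. $f\asymp g$ means $C^{-1}g\le f\le Cg$ for a constant $C>0$ depending on $d$ and $k$ only. $a\vee b=\max(a,b)$, $a\wedge b=\min(a,b)$. Conventions: $a/0=+\infty$ for $a>0$, $\log0=-\infty$, $\log(+\infty)=+\infty$; if the argument of the logarithm is $0/0$ the bracket is read as $1$ (the prefactor is then $+\infty$). *)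

theory Defs
  imports "HOL-Analysis.Analysis"
begin

text \<open>Throughout, \<open>i\<close> is the index of the coordinate called \<open>x\<^sub>1\<close> in the mathematics,
  and \<open>d = CARD('n)\<close>.\<close>

definition root_vec :: "'n::finite \<Rightarrow> real ^ 'n" where
  "root_vec i = axis i (sqrt 2)"

definition reflect :: "'n::finite \<Rightarrow> real ^ 'n \<Rightarrow> real ^ 'n" where
  "reflect i x = (\<chi> j. if j = i then - (x $ j) else x $ j)"

text \<open>Surface measure on the unit sphere, normalised by polar coordinates: the surface measure of
  \<open>A\<close> is \<open>d\<close> times the Lebesgue measure of the cone \<open>{t *\<^sub>R u | 0 < t \<le> 1, u \<in> A}\<close>
  (see \<open>emeasure_sphere_measure\<close>).\<close>

definition sphere_measure :: "'a::euclidean_space measure" where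
  "sphere_measure = scale_measure (ennreal (real DIM('a)))
     (distr (restrict_space lborel (cball 0 1 - {0})) (restrict_space borel (sphere 0 1))
        (\<lambda>x. x /\<^sub>R norm x))"

lemma emeasure_sphere_measure:
  fixes A :: "'a::euclidean_space set"
  assumes "A \<in> sets borel" "A \<subseteq> sphere 0 1"
  shows "emeasure sphere_measure A =
    ennreal (real DIM('a)) * emeasure lborel {t *\<^sub>R u | t u. 0 < t \<and> t \<le> 1 \<and> u \<in> A}"
proof -
  let ?B = "cball 0 1 - {0} :: 'a set"
  have B: "?B \<in> sets borel" by simp
  have m: "(\<lambda>x. x /\<^sub>R norm x) \<in> restrict_space lborel ?B \<rightarrow>\<^sub>M restrict_space borel (sphere 0 1)"
    by (rule measurable_restrict_space2) (auto simp: space_restrict_space intro!: measurable_restrict_space1)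
  have A: "A \<in> sets (restrict_space borel (sphere 0 1))"
    using assms by (auto simp: sets_restrict_space_iff)
  have eq: "(\<lambda>x. x /\<^sub>R norm x) -` A \<inter> ?B = {t *\<^sub>R u | t u. 0 < t \<and> t \<le> 1 \<and> u \<in> A}"
  proof (intro set_eqI iffI)
    fix x assume "x \<in> (\<lambda>x. x /\<^sub>R norm x) -` A \<inter> ?B"
    then show "x \<in> {t *\<^sub>R u | t u. 0 < t \<and> t \<le> 1 \<and> u \<in> A}"
      by (auto intro!: exI[of _ "norm x"] exI[of _ "x /\<^sub>R norm x"])
  next
    fix x assume "x \<in> {t *\<^sub>R u | t u. 0 < t \<and> t \<le> 1 \<and> u \<in> A}"
    then obtain t u where u: "x = t *\<^sub>R u" "0 < t" "t \<le> 1" "u \<in> A" by blast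
    moreover from u assms(2) have "norm u = 1" by auto
    moreover from this have "u \<noteq> 0" by auto
    ultimately show "x \<in> (\<lambda>x. x /\<^sub>R norm x) -` A \<inter> ?B" by auto
  qed
  have "(\<lambda>x. x /\<^sub>R norm x) -` A \<inter> space (restrict_space lborel ?B) = {t *\<^sub>R u | t u. 0 < t \<and> t \<le> 1 \<and> u \<in> A}"
    using eq by (simp add: space_restrict_space)
  moreover have "{t *\<^sub>R u | t u. 0 < t \<and> t \<le> 1 \<and> u \<in> A} \<subseteq> ?B"
    using eq by blast
  ultimately show ?thesis
    using B by (simp add: sphere_measure_def emeasure_distr[OF m A] emeasure_restrict_space)
qed

definition d_const :: "'n::finite \<Rightarrow> real \<Rightarrow> real" where
  "d_const i k = (\<integral>x. \<bar>root_vec i \<bullet> x\<bar> powr (2 * k) \<partial>(sphere_measure :: (real ^ 'n) measure))"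

definition C_const :: "'n::finite \<Rightarrow> real \<Rightarrow> real" where
  "C_const i k = 1 / (d_const i k * (real CARD('n) + 2 * k - 2))"

definition c_const :: "real \<Rightarrow> real" where
  "c_const k = Gamma (k + 1/2) / (sqrt pi * Gamma k)"

text \<open>Division is taken in \<^typ>\<open>ennreal\<close>, so the integrand is \<open>\<infinity>\<close> wherever the base in the
  denominator vanishes, and the kernel takes values in \<open>[0,\<infinity>]\<close>. The endpoints
  \<open>t = -1, 1\<close> are a null set; they are left out because \<open>0 powr (k - 1) = 0\<close> in HOL.\<close>

definition newton_kernel :: "'n::finite \<Rightarrow> real \<Rightarrow> real ^ 'n \<Rightarrow> real ^ 'n \<Rightarrow> ennreal" where
  "newton_kernel i k x y = ennreal (c_const k * C_const i k) *
     (\<integral>\<^sup>+t\<in>{-1<..<1}.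
        ennreal ((1 - t) powr (k - 1) * (1 + t) powr k) /
        ennreal (((norm x)\<^sup>2 + (norm y)\<^sup>2
            - 2 * (t * (x $ i) * (y $ i) + (\<Sum>j\<in>UNIV - {i}. (x $ j) * (y $ j))))
          powr (k + real CARD('n) / 2 - 1))
      \<partial>lborel)"

definition Phi :: "'n::finite \<Rightarrow> real ^ 'n \<Rightarrow> real ^ 'n \<Rightarrow> real" where
  "Phi i x y = max (norm (x - y)) (norm (x - reflect i y))"

definition ext_log :: "ennreal \<Rightarrow> ereal" where
  "ext_log u = (if u = 0 then - \<infinity> else if u = \<infinity> then \<infinity> else ereal (ln (enn2real u)))"

text \<open>The bracket \<open>1 \<or> log (a/b)\<close> for \<open>a, b \<ge> 0\<close>. In \<^typ>\<open>ennreal\<close>, \<open>a / 0 = \<infinity>\<close> for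
  \<open>a > 0\<close>; the case \<open>0/0\<close> is read as \<open>1\<close>.\<close>

definition log_bracket :: "real \<Rightarrow> real \<Rightarrow> ennreal" where
  "log_bracket a b =
     (if a = 0 \<and> b = 0 then 1 else e2ennreal (max 1 (ext_log (ennreal a / ennreal b))))"

definition comparable_with ::
    "real \<Rightarrow> ('a \<Rightarrow> 'a \<Rightarrow> ennreal) \<Rightarrow> ('a \<Rightarrow> 'a \<Rightarrow> ennreal) \<Rightarrow> bool" where
  "comparable_with C f g \<longleftrightarrow>
     (\<forall>x y. ennreal (1 / C) * g x y \<le> f x y \<and> f x y \<le> ennreal C * g x y)"

end

theory Submission
  imports Defs
begin

text \<open>Write \<open>a = |x - y|\<^sup>2\<close> and \<open>b = |x - \<sigma> y|\<^sup>2\<close>. The base in the denominator of the kernel is affine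
  in \<open>t\<close>, equal to \<open>a\<close> at \<open>t = 1\<close> and to \<open>b\<close> at \<open>t = -1\<close>, and \<open>b - a = 4 x\<^sub>1 y\<^sub>1\<close>. So the kernel is a
  constant times a function of the two numbers \<open>a\<close> and \<open>b\<close> alone, and so are the four bounds, since
  \<open>\<Phi>\<^sup>2 = max a b\<close>. The statement is thus about the two-parameter integral \<open>newton_integral\<close> with
  weight \<open>(1 - t)\<^sup>p\<^sup>-\<^sup>1 (1 + t)\<^sup>q\<^sup>-\<^sup>1\<close>, where \<open>p = k\<close>, \<open>q = k + 1\<close>, and exponent \<open>m = k + d/2 - 1\<close>.

  The substitution \<open>t \<mapsto> -t\<close> exchanges \<open>(p, a)\<close> with \<open>(q, b)\<close>, so it is enough to treat \<open>a \<le> b\<close>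
  for both pairs of exponents. By homogeneity only the ratio \<open>r = a / b\<close> in \<open>[0, 1]\<close> matters, and
  with \<open>s = (1 - t) / 2\<close> one has to find the size of
  \<open>\<integral> s\<^sup>p\<^sup>-\<^sup>1 (1 - s)\<^sup>q\<^sup>-\<^sup>1 (r + (1 - r) s)\<^sup>-\<^sup>m ds\<close> over \<open>(0, 1)\<close>. The last base lies between
  \<open>max r s\<close> and \<open>2 max r s\<close>, so the integral is comparable to 1 when \<open>m < p\<close>, grows like
  \<open>log (1/r)\<close> when \<open>m = p\<close>, and like \<open>r\<^sup>p\<^sup>-\<^sup>m\<close> when \<open>m > p\<close>. This is \<open>weighted_integral_estimate\<close>;
  the value \<open>\<infinity>\<close> at \<open>r = 0\<close> for \<open>m \<ge> p\<close> comes from monotonicity in \<open>r\<close>.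

  In the case \<open>a \<le> b\<close> the deciding difference is \<open>m - p = d/2 - 1\<close>. In the case \<open>b \<le> a\<close> the exponent
  \<open>q\<close> takes the place of \<open>p\<close>, and the difference is \<open>m - q = d/2 - 2\<close>. The signs explain the logarithm of \<open>1 / |x - y|\<^sup>2\<close> in dimension 2, that of
  \<open>1 / |x - \<sigma> y|\<^sup>2\<close> in dimension 4, and the minimum in dimensions at least 5. Finally
  the constant in front of the kernel is positive because \<open>d\<^sub>k\<close> is (\<open>d_const_pos\<close>).\<close>

section \<open>Comparability of extended nonnegative numbers\<close>

text \<open>The pointwise version of \<open>comparable_with\<close>, which allows estimates on part of the domain to be
  chained and then glued together.\<close>

definition within_factor :: "real \<Rightarrow> ennreal \<Rightarrow> ennreal \<Rightarrow> bool" where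
  "within_factor C f g \<longleftrightarrow> ennreal (1 / C) * g \<le> f \<and> f \<le> ennreal C * g"

lemma within_factor_mono:
  assumes "within_factor C f g" "0 < C" "C \<le> D"
  shows "within_factor D f g"
proof -
  have "ennreal (1 / D) \<le> ennreal (1 / C)" "ennreal C \<le> ennreal D"
    using assms by (auto intro!: ennreal_leI simp: field_simps)
  then show ?thesis
    using assms(1) unfolding within_factor_def
    by (meson mult_right_mono order_trans zero_le)
qed

lemma within_factor_trans:
  assumes "within_factor C f g" "within_factor D g h" "0 < C" "0 < D"
  shows "within_factor (C * D) f h"
proof -
  have "ennreal (1 / (C * D)) * h = ennreal (1 / C) * (ennreal (1 / D) * h)"
    using assms by (simp add: ennreal_mult[symmetric] mult.assoc[symmetric])
  also have "\<dots> \<le> ennreal (1 / C) * g"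
    using assms by (intro mult_left_mono) (auto simp: within_factor_def)
  finally have 1: "ennreal (1 / (C * D)) * h \<le> f"
    using assms(1) by (auto simp: within_factor_def)
  have "f \<le> ennreal C * g"
    using assms(1) by (auto simp: within_factor_def)
  also have "\<dots> \<le> ennreal C * (ennreal D * h)"
    using assms by (intro mult_left_mono) (auto simp: within_factor_def)
  also have "\<dots> = ennreal (C * D) * h"
    using assms by (simp add: ennreal_mult mult.assoc)
  finally show ?thesis using 1 by (simp add: within_factor_def)
qed

lemma within_factor_sym:
  assumes "within_factor C f g" "0 < C"
  shows "within_factor C g f"
proof -
  have e: "ennreal C * ennreal (1 / C) = 1"
    using assms(2) by (simp add: ennreal_mult[symmetric])
  have "g = ennreal C * (ennreal (1 / C) * g)" using e by (simp add: mult.assoc[symmetric])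
  also have "\<dots> \<le> ennreal C * f"
    using assms by (intro mult_left_mono) (auto simp: within_factor_def)
  finally have 1: "g \<le> ennreal C * f" .
  have "ennreal (1 / C) * f \<le> ennreal (1 / C) * (ennreal C * g)"
    using assms by (intro mult_left_mono) (auto simp: within_factor_def)
  also have "\<dots> = g" using e by (simp add: mult.assoc[symmetric] mult.commute[of "ennreal (1 / C)" "ennreal C"])
  finally show ?thesis using 1 by (simp add: within_factor_def)
qed

lemma within_factor_mult:
  assumes "within_factor C f g"
  shows "within_factor C (c * f) (c * g)"
  using assms mult_left_mono[of _ _ c] unfolding within_factor_def
  by (metis mult.left_commute zero_le)

lemma within_factor_scaled:
  assumes "0 < c"
  shows "within_factor (max c (1 / c)) (ennreal c * f) f"
proof -
  have "ennreal (1 / max c (1 / c)) \<le> ennreal c" "ennreal c \<le> ennreal (max c (1 / c))"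
    using assms by (auto intro!: ennreal_leI simp: max_def field_simps)
  then show ?thesis unfolding within_factor_def by (auto intro: mult_right_mono)
qed

lemma within_factor_refl: "within_factor 1 f f"
  by (simp add: within_factor_def)

lemma within_factorI:
  assumes "0 < c" "0 < d" "ennreal c * g \<le> f" "f \<le> ennreal d * g"
  shows "within_factor (max d (1 / c)) f g"
proof -
  have "ennreal (1 / max d (1 / c)) \<le> ennreal c" "ennreal d \<le> ennreal (max d (1 / c))"
    using assms by (auto intro!: ennreal_leI simp: max_def field_simps)
  then show ?thesis using assms(3,4) unfolding within_factor_def
    by (meson mult_right_mono order_trans zero_le)
qed

section \<open>The normalised integral on the unit interval\<close>

text \<open>The kernel integral for \<open>b = 1\<close> and \<open>a = r\<close> in the variable \<open>s = (1 - t) / 2\<close>, up to a power of 2.\<close>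

definition weighted_integral :: "real \<Rightarrow> real \<Rightarrow> real \<Rightarrow> real \<Rightarrow> ennreal" where
  "weighted_integral p q m r =
     (\<integral>\<^sup>+s\<in>{0<..<1}. ennreal (s powr (p - 1) * (1 - s) powr (q - 1) *
        (r + (1 - r) * s) powr - m) \<partial>lborel)"

text \<open>The growth of \<open>weighted_integral p q m r\<close> as \<open>r\<close> tends to 0, as a function of the excess
  \<open>\<delta> = m - p\<close> of the singularity of the kernel over the order \<open>p\<close> of the weight at \<open>s = 0\<close>. The
  maximum with 1 keeps the critical profile away from 0 as \<open>r\<close> tends to 1.\<close>

definition profile :: "real \<Rightarrow> real \<Rightarrow> ennreal" where
  "profile \<delta> r =
     (if \<delta> < 0 then 1 else if r = 0 then \<infinity>
      else if \<delta> = 0 then ennreal (max 1 (- ln r)) else ennreal (r powr - \<delta>))"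

lemma nn_integral_beta_density:
  assumes "0 < p" "0 < q"
  shows "(\<integral>\<^sup>+s\<in>{0<..<1}. ennreal (s powr (p - 1) * (1 - s) powr (q - 1)) \<partial>lborel) = ennreal (Beta p q)"
proof -
  \<comment> \<open>The integrands agree at the endpoints, as \<open>0 powr e = 0\<close> for every \<open>e\<close>.\<close>
  have "(\<integral>\<^sup>+s\<in>{0<..<1}. ennreal (s powr (p - 1) * (1 - s) powr (q - 1)) \<partial>lborel)
      = (\<integral>\<^sup>+s. ennreal (s powr (p - 1) * (1 - s) powr (q - 1)) * indicator {0..1} s \<partial>lborel)"
    by (intro nn_integral_cong) (auto simp: indicator_def less_le)
  also have "\<dots> = ennreal (Beta p q)"
    by (rule nn_integral_has_integral_lebesgue') (use has_integral_Beta_real[OF assms] in auto)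
  finally show ?thesis .
qed

lemma Beta_pos: "0 < p \<Longrightarrow> 0 < q \<Longrightarrow> 0 < Beta p (q :: real)"
  by (simp add: Beta_def Gamma_real_pos)

lemma nn_integral_inverse_Icc:
  assumes "0 < a" "a \<le> b"
  shows "(\<integral>\<^sup>+s. ennreal (1 / s) * indicator {a..b} s \<partial>lborel) = ennreal (ln b - ln a)"
  by (rule nn_integral_FTC_Icc) (use assms in \<open>auto intro!: derivative_eq_intros\<close>)

lemma nn_integral_powr_Icc:
  assumes "0 < a" "a \<le> b" "e \<noteq> 0"
  shows "(\<integral>\<^sup>+s. ennreal (s powr (e - 1)) * indicator {a..b} s \<partial>lborel) = ennreal ((b powr e - a powr e) / e)"
proof -
  have "(\<integral>\<^sup>+s. ennreal (s powr (e - 1)) * indicator {a..b} s \<partial>lborel) = ennreal (b powr e / e - a powr e / e)"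
    by (rule nn_integral_FTC_Icc) (use assms in \<open>auto intro!: derivative_eq_intros\<close>)
  then show ?thesis by (simp add: diff_divide_distrib)
qed

lemma nn_integral_powr_from_0:
  assumes "0 < e" "0 \<le> b"
  shows "(\<integral>\<^sup>+s. ennreal (s powr (e - 1)) * indicator {0..b} s \<partial>lborel) = ennreal (b powr e / e)"
  by (rule nn_integral_has_integral_lebesgue')
     (use has_integral_powr_from_0[of "e - 1" b] assms in auto)

text \<open>The base is a convex combination of \<open>r\<close> and \<open>1\<close>, and of \<open>s\<close> and \<open>1\<close>, and it is at most
  \<open>r + s\<close>. So it is comparable to \<open>max r s\<close>, which separates the regions
  \<open>s < r\<close> and \<open>s > r\<close> in the estimates below.\<close>

lemma base_bounds:
  fixes r s :: real
  assumes "0 \<le> r" "r \<le> 1" "0 < s" "s < 1"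
  shows "r \<le> r + (1 - r) * s" "s \<le> r + (1 - r) * s" "r + (1 - r) * s \<le> r + s" "r + (1 - r) * s \<le> 1"
proof -
  have "0 \<le> r * (1 - s)" "0 \<le> (1 - r) * s" "0 \<le> r * s" "0 \<le> (1 - r) * (1 - s)" using assms by auto
  then show "r \<le> r + (1 - r) * s" "s \<le> r + (1 - r) * s" "r + (1 - r) * s \<le> r + s" "r + (1 - r) * s \<le> 1"
    by (auto simp: algebra_simps)
qed

lemma powr_minus_antimono: "0 < x \<Longrightarrow> x \<le> y \<Longrightarrow> 0 \<le> m \<Longrightarrow> y powr - m \<le> x powr - (m::real)"
  by (simp add: powr_mono2')

lemma weighted_integral_ge_Beta:
  assumes "0 < p" "0 < q" "0 \<le> m" "0 \<le> r" "r \<le> 1"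
  shows "ennreal (Beta p q) \<le> weighted_integral p q m r"
  unfolding nn_integral_beta_density[OF assms(1,2), symmetric] weighted_integral_def
proof (rule nn_integral_mono)
  fix s :: real
  show "ennreal (s powr (p - 1) * (1 - s) powr (q - 1)) * indicator {0<..<1} s
      \<le> ennreal (s powr (p - 1) * (1 - s) powr (q - 1) * (r + (1 - r) * s) powr - m) * indicator {0<..<1} s"
  proof (cases "s \<in> {0<..<1}")
    case True
    then have s: "0 < s" "s < 1" by auto
    have "1 powr - m \<le> (r + (1 - r) * s) powr - m"
      using base_bounds[OF assms(4,5) s] s assms by (intro powr_minus_antimono) linarith+
    then show ?thesis using True by (auto intro!: ennreal_leI mult_left_mono[of 1, simplified] simp: mult_nonneg_nonneg)
  qed auto
qed

lemma weighted_integral_le_Beta: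
  assumes "0 < p" "0 < q" "0 \<le> m" "m < p" "0 \<le> r" "r \<le> 1"
  shows "weighted_integral p q m r \<le> ennreal (Beta (p - m) q)"
proof -
  have pm: "0 < p - m" using assms by simp
  show ?thesis
    unfolding nn_integral_beta_density[OF pm assms(2), symmetric] weighted_integral_def
  proof (rule nn_integral_mono)
    fix s :: real
    show "ennreal (s powr (p - 1) * (1 - s) powr (q - 1) * (r + (1 - r) * s) powr - m) * indicator {0<..<1} s
      \<le> ennreal (s powr (p - m - 1) * (1 - s) powr (q - 1)) * indicator {0<..<1} s"
    proof (cases "s \<in> {0<..<1}")
      case True
      then have s: "0 < s" "s < 1" by auto
      have "(r + (1 - r) * s) powr - m \<le> s powr - m"
        using base_bounds[OF assms(5,6) s] s assms by (intro powr_minus_antimono) linarith+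
      then have "s powr (p - 1) * (1 - s) powr (q - 1) * (r + (1 - r) * s) powr - m
         \<le> s powr (p - 1) * (1 - s) powr (q - 1) * s powr - m"
        by (intro mult_left_mono) auto
      also have "\<dots> = s powr (p - 1 + - m) * (1 - s) powr (q - 1)" by (simp only: powr_add mult_ac)
      also have "p - 1 + - m = p - m - 1" by simp
      finally show ?thesis by (intro mult_right_mono ennreal_leI) auto
    qed auto
  qed
qed

lemma weighted_integral_antimono:
  assumes "0 \<le> m" "0 \<le> r" "r \<le> r'" "r' \<le> 1"
  shows "weighted_integral p q m r' \<le> weighted_integral p q m r"
  unfolding weighted_integral_def
proof (rule nn_integral_mono)
  fix s :: real
  show "ennreal (s powr (p - 1) * (1 - s) powr (q - 1) * (r' + (1 - r') * s) powr - m) * indicator {0<..<1} s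
      \<le> ennreal (s powr (p - 1) * (1 - s) powr (q - 1) * (r + (1 - r) * s) powr - m) * indicator {0<..<1} s"
  proof (cases "s \<in> {0<..<1}")
    case True
    then have s: "0 < s" "s < 1" by auto
    have "0 \<le> (r' - r) * (1 - s)" using assms s by auto
    then have "(r' + (1 - r') * s) powr - m \<le> (r + (1 - r) * s) powr - m"
      using base_bounds[of r s] s assms by (intro powr_minus_antimono) (auto simp: algebra_simps)
    then show ?thesis by (auto intro!: ennreal_leI mult_left_mono mult_right_mono)
  qed auto
qed

text \<open>Away from \<open>s = 1\<close> the second factor of the weight is comparable to 1; the form of the bounds
  covers both signs of \<open>q - 1\<close>.\<close>

lemma weight_bounds_near_0:
  fixes s q :: real
  assumes "0 < s" "s \<le> 1/2"
  shows "(1 - s) powr (q - 1) \<le> max 1 (2 powr (1 - q))"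
    "min 1 (2 powr (1 - q)) \<le> (1 - s) powr (q - 1)"
proof -
  have e: "(2::real) powr (1 - q) = (1/2) powr (q - 1)"
    using powr_minus[of "2::real" "q - 1"] by (simp add: powr_divide field_simps)
  consider "q \<ge> 1" | "q < 1" by linarith
  then have "(1 - s) powr (q - 1) \<le> max 1 (2 powr (1 - q)) \<and> min 1 (2 powr (1 - q)) \<le> (1 - s) powr (q - 1)"
  proof cases
    case 1
    have "(1 - s) powr (q - 1) \<le> 1 powr (q - 1)" using assms 1 by (intro powr_mono2) auto
    moreover have "(1/2) powr (q - 1) \<le> (1 - s) powr (q - 1)" using assms 1 by (intro powr_mono2) auto
    ultimately show ?thesis unfolding e by auto
  next
    case 2
    have "1 powr (q - 1) \<le> (1 - s) powr (q - 1)" using assms 2 by (intro powr_mono2') auto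
    moreover have "(1 - s) powr (q - 1) \<le> (1/2) powr (q - 1)" using assms 2 by (intro powr_mono2') auto
    ultimately show ?thesis unfolding e by auto
  qed
  then show "(1 - s) powr (q - 1) \<le> max 1 (2 powr (1 - q))"
    "min 1 (2 powr (1 - q)) \<le> (1 - s) powr (q - 1)" by auto
qed

text \<open>For \<open>s > 1/2\<close> the base is at least \<open>1/2\<close>, which gives a multiple of the Beta integral; this takes
  care of the singularity of the weight at \<open>s = 1\<close> when \<open>q < 1\<close>. For \<open>s \<le> 1/2\<close> the base is
  bounded below by \<open>r\<close> when \<open>s \<le> r\<close> and by \<open>s\<close> when \<open>s > r\<close>.\<close>

lemma weighted_integral_le_split:
  assumes "0 < p" "0 < q" "0 \<le> m" "0 < r" "r \<le> 1"
  defines "c \<equiv> max 1 (2 powr (1 - q))"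
  shows "weighted_integral p q m r \<le> ennreal (2 powr m * Beta p q) + ennreal (c * r powr (p - m) / p)
     + ennreal c * (\<integral>\<^sup>+s. ennreal (s powr (p - m - 1)) * indicator {r..1} s \<partial>lborel)"
proof -
  let ?w = "\<lambda>s::real. s powr (p - 1) * (1 - s) powr (q - 1)"
  have c: "c \<ge> 1" by (simp add: c_def)
  have "weighted_integral p q m r \<le> (\<integral>\<^sup>+s. 
      ennreal (2 powr m) * (ennreal (?w s) * indicator {0<..<1} s)
      + ennreal (c * r powr - m) * (ennreal (s powr (p - 1)) * indicator {0..r} s)
      + ennreal c * (ennreal (s powr (p - m - 1)) * indicator {r..1} s) \<partial>lborel)"
    unfolding weighted_integral_def
  proof (rule nn_integral_mono)
    fix s :: real
    show "ennreal (?w s * (r + (1 - r) * s) powr - m) * indicator {0<..<1} s \<le>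
      ennreal (2 powr m) * (ennreal (?w s) * indicator {0<..<1} s)
      + ennreal (c * r powr - m) * (ennreal (s powr (p - 1)) * indicator {0..r} s)
      + ennreal c * (ennreal (s powr (p - m - 1)) * indicator {r..1} s)" (is "?L \<le> ?A + ?B + ?C")
    proof (cases "s \<in> {0<..<1}")
      case True
      then have s: "0 < s" "s < 1" by auto
      note b = base_bounds[OF less_imp_le[OF assms(4)] assms(5) s]
      consider "s > 1/2" | "s \<le> 1/2" "s \<le> r" | "s \<le> 1/2" "s > r" by linarith
      then show ?thesis
      proof cases
        case 1
        have "(r + (1 - r) * s) powr - m \<le> (1/2) powr - m"
          using b 1 assms by (intro powr_minus_antimono) linarith+
        also have "\<dots> = 2 powr m" by (simp add: powr_minus powr_divide)
        finally have "?w s * (r + (1 - r) * s) powr - m \<le> 2 powr m * ?w s"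
          using mult_left_mono[of _ "2 powr m" "?w s"] by (simp add: mult.commute)
        then have "?L \<le> ?A" using True by (simp add: ennreal_leI flip: ennreal_mult)
        then show ?thesis by (simp add: add_increasing2 add.assoc)
      next
        case 2
        have m: "(r + (1 - r) * s) powr - m \<le> r powr - m"
          using b 2 assms by (intro powr_minus_antimono) linarith+
        have w: "?w s \<le> s powr (p - 1) * c"
          unfolding c_def using weight_bounds_near_0(1)[OF s(1) 2(1)] by (intro mult_left_mono) auto
        have "?w s * (r + (1 - r) * s) powr - m \<le> (s powr (p - 1) * c) * r powr - m"
          using c by (intro mult_mono[OF w m]) auto
        then have "?L \<le> ?B" using True 2 c by (simp add: ennreal_leI mult_ac flip: ennreal_mult)
        then show ?thesis by (simp add: add_increasing2 add_increasing)
      next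
        case 3
        have m: "(r + (1 - r) * s) powr - m \<le> s powr - m"
          using b 3 assms s by (intro powr_minus_antimono) linarith+
        have w: "?w s \<le> s powr (p - 1) * c"
          unfolding c_def using weight_bounds_near_0(1)[OF s(1) 3(1)] by (intro mult_left_mono) auto
        have "?w s * (r + (1 - r) * s) powr - m \<le> (s powr (p - 1) * c) * s powr - m"
          using c by (intro mult_mono[OF w m]) auto
        also have "\<dots> = c * s powr (p - 1 + - m)" by (simp only: powr_add mult_ac)
        also have "p - 1 + - m = p - m - 1" by simp
        finally have "?L \<le> ?C" using True 3 c by (simp add: ennreal_leI mult_ac flip: ennreal_mult)
        then show ?thesis by (simp add: add_increasing2 add_increasing)
      qed
    qed auto
  qed
  also have "\<dots> = ennreal (2 powr m) * (\<integral>\<^sup>+s\<in>{0<..<1}. ennreal (?w s) \<partial>lborel)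
      + ennreal (c * r powr - m) * (\<integral>\<^sup>+s. ennreal (s powr (p - 1)) * indicator {0..r} s \<partial>lborel)
      + ennreal c * (\<integral>\<^sup>+s. ennreal (s powr (p - m - 1)) * indicator {r..1} s \<partial>lborel)"
    by (simp add: nn_integral_add nn_integral_cmult)
  also have "(\<integral>\<^sup>+s. ennreal (s powr (p - 1)) * indicator {0..r} s \<partial>lborel) = ennreal (r powr p / p)"
    using assms by (intro nn_integral_powr_from_0) auto
  also have "ennreal (c * r powr - m) * ennreal (r powr p / p) = ennreal (c * r powr (p - m) / p)"
    using assms c by (simp add: powr_diff powr_minus field_simps flip: ennreal_mult)
  also have "ennreal (2 powr m) * (\<integral>\<^sup>+s\<in>{0<..<1}. ennreal (?w s) \<partial>lborel) = ennreal (2 powr m * Beta p q)"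
    using assms Beta_pos[of p q] by (simp only: nn_integral_beta_density) (simp add: ennreal_mult')
  finally show ?thesis .
qed

text \<open>All lower bounds other than the Beta integral come from a subinterval of \<open>[0, 1/2]\<close>, on which
  \<open>(1 - s)\<^sup>q\<^sup>-\<^sup>1\<close> is bounded below and the base is at most \<open>r + s\<close>.
  The condition on \<open>h 0\<close> accounts for the point 0, which lies in the subinterval if \<open>u = 0\<close> but not in
  the domain of integration.\<close>

lemma weighted_integral_ge_subinterval:
  assumes "0 \<le> r" "r \<le> 1" "0 \<le> v" "v \<le> 1/2" "0 < c"
    and base: "\<And>s. 0 < s \<Longrightarrow> s \<in> {u..v} \<Longrightarrow> c * h s \<le> s powr (p - 1) * (r + s) powr - m"
    and "0 \<le> u" "0 \<le> m" "\<And>s. 0 \<le> h s" "u = 0 \<Longrightarrow> h 0 = 0" and [measurable]: "h \<in> borel_measurable borel"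
  shows "ennreal (min 1 (2 powr (1 - q)) * c) * (\<integral>\<^sup>+s. ennreal (h s) * indicator {u..v} s \<partial>lborel)
    \<le> weighted_integral p q m r"
proof -
  have "ennreal (min 1 (2 powr (1 - q)) * c) * (\<integral>\<^sup>+s. ennreal (h s) * indicator {u..v} s \<partial>lborel)
      = (\<integral>\<^sup>+s. ennreal (min 1 (2 powr (1 - q)) * c) * (ennreal (h s) * indicator {u..v} s) \<partial>lborel)"
    by (simp add: nn_integral_cmult)
  also have "\<dots> \<le> weighted_integral p q m r" 
    unfolding weighted_integral_def
  proof (rule nn_integral_mono)
    fix s :: real
    show "ennreal (min 1 (2 powr (1 - q)) * c) * (ennreal (h s) * indicator {u..v} s) \<le>
      ennreal (s powr (p - 1) * (1 - s) powr (q - 1) * (r + (1 - r) * s) powr - m) * indicator {0<..<1} s"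
    proof (cases "s \<in> {u..v} \<and> s \<noteq> 0")
      case True
      then have s: "0 < s" "s < 1" "s \<le> 1/2" using assms by auto
      note b = base_bounds[OF assms(1,2) s(1,2)]
      have "c * h s \<le> s powr (p - 1) * (r + (1 - r) * s) powr - m"
      proof -
        have "(r + s) powr - m \<le> (r + (1 - r) * s) powr - m"
          using b s assms by (intro powr_minus_antimono) linarith+
        then have "s powr (p - 1) * (r + s) powr - m \<le> s powr (p - 1) * (r + (1 - r) * s) powr - m"
          by (intro mult_left_mono) auto
        then show ?thesis
          using base[of s] s True by (meson order_trans)
      qed
      from mult_mono[OF weight_bounds_near_0(2)[OF s(1,3)] this, of q]
      have "min 1 (2 powr (1 - q)) * (c * h s) \<le> (1 - s) powr (q - 1) * (s powr (p - 1) * (r + (1 - r) * s) powr - m)"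
        using assms by simp
      then show ?thesis using True s assms by (simp add: mult_ac ennreal_leI flip: ennreal_mult)
    next
      case False
      then show ?thesis using assms by (auto simp: indicator_def)
    qed
  qed
  finally show ?thesis .
qed

section \<open>Size of the normalised integral\<close>

lemma weighted_integral_subcritical:
  assumes "0 < p" "0 < q" "0 \<le> m" "m < p"
  shows "\<exists>C>0. \<forall>r\<in>{0..1}. within_factor C (weighted_integral p q m r) (profile (m - p) r)"
proof -
  have "within_factor (max (Beta (p - m) q) (1 / Beta p q)) (weighted_integral p q m r) (profile (m - p) r)"
    if "r \<in> {0..1}" for r
    using that assms weighted_integral_ge_Beta[of p q m r] weighted_integral_le_Beta[of p q m r]
    by (intro within_factorI) (auto simp: profile_def Beta_pos)
  then show ?thesis using Beta_pos[of p q] assms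
    by (intro exI[of _ "max (Beta (p - m) q) (1 / Beta p q)"]) (auto simp: less_max_iff_disj)
qed

text \<open>Upper bound: the region \<open>s > r\<close> contributes the integral of \<open>1/s\<close>. Lower bound: the interval
  \<open>[r/2, 1/2]\<close> yields a multiple of \<open>log (1/r)\<close>, because \<open>r + s \<le> 3 s\<close> there, and the Beta integral takes over when
  this logarithm is less than 1.\<close>

lemma weighted_integral_critical_pos:
  assumes "0 < p" "0 < q"
  shows "\<exists>C>0. \<forall>r\<in>{0<..1}. within_factor C (weighted_integral p q p r) (profile 0 r)"
proof -
  define c where "c = max 1 (2 powr (1 - q))"
  define D where "D = 2 powr p * Beta p q + c / p + c"
  define e where "e = min 1 (2 powr (1 - q)) * 3 powr - p"
  define E where "E = min (Beta p q) e"
  have B: "0 < Beta p q" using assms by (rule Beta_pos)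
  have c: "c \<ge> 1" by (simp add: c_def)
  have D: "0 < D" unfolding D_def using B c assms by (intro add_pos_pos) auto
  have e: "0 < e" by (simp add: e_def)
  have E: "0 < E" using B e by (simp add: E_def)
  have "within_factor (max D (1 / E)) (weighted_integral p q p r) (profile 0 r)"
    if r: "r \<in> {0<..1}" for r
  proof (rule within_factorI[OF E D])
    let ?L = "max 1 (- ln r)"
    have pr: "profile 0 r = ennreal ?L" using r by (simp add: profile_def)
    have "weighted_integral p q p r \<le> ennreal (2 powr p * Beta p q) + ennreal (c * r powr (p - p) / p)
       + ennreal c * (\<integral>\<^sup>+s. ennreal (s powr (p - p - 1)) * indicator {r..1} s \<partial>lborel)"
      unfolding c_def by (rule weighted_integral_le_split) (use assms r in auto)
    also have "(\<integral>\<^sup>+s. ennreal (s powr (p - p - 1)) * indicator {r..1} s \<partial>lborel)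
        = (\<integral>\<^sup>+s. ennreal (1 / s) * indicator {r..1} s \<partial>lborel)"
      using r by (intro nn_integral_cong) (auto simp: indicator_def powr_minus field_simps)
    also have "\<dots> = ennreal (ln 1 - ln r)" using r by (intro nn_integral_inverse_Icc) auto
    also have "ennreal (2 powr p * Beta p q) + ennreal (c * r powr (p - p) / p) + ennreal c * ennreal (ln 1 - ln r)
        = ennreal (2 powr p * Beta p q + c / p + c * (- ln r))"
    proof -
      have "ennreal c * ennreal (ln 1 - ln r) = ennreal (c * (- ln r))"
        using c ennreal_mult'[of c "- ln r"] by simp
      moreover have "0 \<le> c * (- ln r)" using c r by (intro mult_nonneg_nonneg) auto
      ultimately show ?thesis
        using r B c assms by (simp only:) (simp flip: ennreal_plus)
    qed
    also have "\<dots> \<le> ennreal (D * ?L)"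
    proof (rule ennreal_leI)
      have "(2 powr p * Beta p q + c / p) * 1 \<le> (2 powr p * Beta p q + c / p) * ?L"
        using B c assms by (intro mult_left_mono) auto
      moreover have "c * (- ln r) \<le> c * ?L" using c by (intro mult_left_mono) auto
      ultimately show "2 powr p * Beta p q + c / p + c * (- ln r) \<le> D * ?L"
        by (simp add: D_def distrib_right)
    qed
    finally show "weighted_integral p q p r \<le> ennreal D * profile 0 r"
      using D by (simp add: pr ennreal_mult')
    have "ennreal (min 1 (2 powr (1 - q)) * 3 powr - p) * 
         (\<integral>\<^sup>+s. ennreal (1 / s) * indicator {r/2..1/2} s \<partial>lborel) \<le> weighted_integral p q p r"
      if "r < 1"
    proof -
      have "ennreal (min 1 (2 powr (1 - q)) * 3 powr - p) * 
         (\<integral>\<^sup>+s. ennreal (\<bar>1 / s\<bar>) * indicator {r/2..1/2} s \<partial>lborel) \<le> weighted_integral p q p r"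
      proof (rule weighted_integral_ge_subinterval)
        fix s :: real assume s: "0 < s" "s \<in> {r/2..1/2}"
        have "3 powr - p * \<bar>1 / s\<bar> = s powr (p - 1) * (3 * s) powr - p"
          using s by (simp add: powr_mult powr_minus powr_diff field_simps)
        also have "\<dots> \<le> s powr (p - 1) * (r + s) powr - p"
          using s r assms by (intro mult_left_mono powr_minus_antimono) auto
        finally show "3 powr - p * \<bar>1 / s\<bar> \<le> s powr (p - 1) * (r + s) powr - p" .
      qed (use r assms in auto)
      also have "(\<integral>\<^sup>+s. ennreal (\<bar>1 / s\<bar>) * indicator {r/2..1/2} s \<partial>lborel)
         = (\<integral>\<^sup>+s. ennreal (1 / s) * indicator {r/2..1/2} s \<partial>lborel)"
        using r by (intro nn_integral_cong) (auto simp: indicator_def)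
      finally show ?thesis .
    qed
    \<comment> \<open>Both endpoints are halved, so that the logarithm of their ratio is exactly \<open>log (1/r)\<close>.\<close>
    moreover have "(\<integral>\<^sup>+s. ennreal (1 / s) * indicator {r/2..1/2} s \<partial>lborel) = ennreal (- ln r)"
      using r nn_integral_inverse_Icc[of "r/2" "1/2"] by (simp add: ln_div)
    ultimately have lo: "ennreal (e * (- ln r)) \<le> weighted_integral p q p r"
      using r e by (cases "r < 1") (auto simp: e_def simp flip: ennreal_mult)
    have "ennreal (E * ?L) \<le> weighted_integral p q p r"
    proof (cases "- ln r \<ge> 1")
      case True
      then have "E * ?L \<le> e * (- ln r)" using True by (simp add: E_def max_def)
      then show ?thesis using lo by (meson ennreal_leI order_trans)
    next
      case False
      then have "E * ?L \<le> Beta p q" by (simp add: E_def max_def)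
      then show ?thesis using weighted_integral_ge_Beta[of p q p r] assms r
        by (auto intro: order_trans[OF ennreal_leI])
    qed
    then show "ennreal E * profile 0 r \<le> weighted_integral p q p r"
      using E by (simp add: pr ennreal_mult')
  qed
  moreover have "0 < max D (1 / E)" using D by (simp add: less_max_iff_disj)
  ultimately show ?thesis by blast
qed

text \<open>Both regions \<open>s < r\<close> and \<open>s > r\<close> contribute at most a multiple of \<open>r\<^sup>p\<^sup>-\<^sup>m\<close>, and the interval
  \<open>[0, r/2]\<close>, where \<open>r + s \<le> 2 r\<close>, already yields as much.\<close>

lemma weighted_integral_supercritical_pos:
  assumes "0 < p" "0 < q" "p < m"
  shows "\<exists>C>0. \<forall>r\<in>{0<..1}. within_factor C (weighted_integral p q m r) (profile (m - p) r)"
proof -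
  define c where "c = max 1 (2 powr (1 - q))"
  define D where "D = 2 powr m * Beta p q + c / p + c / (m - p)"
  define e where "e = min 1 (2 powr (1 - q)) * 2 powr - m"
  define E where "E = e * ((1 / 2) powr p / p)"
  have B: "0 < Beta p q" using assms by (intro Beta_pos)
  have c: "c \<ge> 1" by (simp add: c_def)
  have D: "0 < D" unfolding D_def using B c assms by (intro add_pos_pos) auto
  have e: "0 < e" by (simp add: e_def)
  have E: "0 < E" using e assms by (simp add: E_def)
  have "within_factor (max D (1 / E)) (weighted_integral p q m r) (profile (m - p) r)"
    if r: "r \<in> {0<..1}" for r
  proof (rule within_factorI[OF E D])
    let ?L = "r powr (p - m)"
    have pr: "profile (m - p) r = ennreal ?L" using r assms by (simp add: profile_def)
    have L: "1 \<le> ?L" using r assms powr_mono2'[of "p - m" r 1] by simp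
    have "weighted_integral p q m r \<le> ennreal (2 powr m * Beta p q) + ennreal (c * r powr (p - m) / p)
       + ennreal c * (\<integral>\<^sup>+s. ennreal (s powr (p - m - 1)) * indicator {r..1} s \<partial>lborel)"
      unfolding c_def by (rule weighted_integral_le_split) (use assms r in auto)
    also have "(\<integral>\<^sup>+s. ennreal (s powr (p - m - 1)) * indicator {r..1} s \<partial>lborel)
        = ennreal ((1 powr (p - m) - ?L) / (p - m))" using r assms by (intro nn_integral_powr_Icc) auto
    also have "(1 powr (p - m) - ?L) / (p - m) = (?L - 1) / (m - p)"
      using assms by (simp add: field_simps)
    also have "ennreal (2 powr m * Beta p q) + ennreal (c * ?L / p) + ennreal c * ennreal ((?L - 1) / (m - p))
        = ennreal (2 powr m * Beta p q + c * ?L / p + c * ((?L - 1) / (m - p)))"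
      using r B c L assms by (simp add: less_imp_le flip: ennreal_plus ennreal_mult)
    also have "\<dots> \<le> ennreal (D * ?L)"
    proof (rule ennreal_leI)
      have "(2 powr m * Beta p q) * 1 \<le> (2 powr m * Beta p q) * ?L"
        using B L by (intro mult_left_mono) auto
      moreover have "c * ((?L - 1) / (m - p)) \<le> c * (?L / (m - p))"
        using c assms by (intro mult_left_mono divide_right_mono) auto
      moreover have "D * ?L = 2 powr m * Beta p q * ?L + c * ?L / p + c * (?L / (m - p))"
        by (simp add: D_def distrib_right)
      ultimately show "2 powr m * Beta p q + c * ?L / p + c * ((?L - 1) / (m - p)) \<le> D * ?L"
        by linarith
    qed
    finally show "weighted_integral p q m r \<le> ennreal D * profile (m - p) r"
      using D by (simp add: pr ennreal_mult')
    have "ennreal (min 1 (2 powr (1 - q)) * (2 * r) powr - m) * 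
         (\<integral>\<^sup>+s. ennreal (s powr (p - 1)) * indicator {0..r/2} s \<partial>lborel) \<le> weighted_integral p q m r"
    proof (rule weighted_integral_ge_subinterval)
      fix s :: real assume s: "0 < s" "s \<in> {0..r/2}"
      have "s powr (p - 1) * (2 * r) powr - m \<le> s powr (p - 1) * (r + s) powr - m"
        using s r assms by (intro mult_left_mono powr_minus_antimono) auto
      then show "(2 * r) powr - m * s powr (p - 1) \<le> s powr (p - 1) * (r + s) powr - m"
        by (simp add: mult.commute)
    qed (use r assms in auto)
    also have "(\<integral>\<^sup>+s. ennreal (s powr (p - 1)) * indicator {0..r/2} s \<partial>lborel) = ennreal ((r/2) powr p / p)"
      using r assms by (intro nn_integral_powr_from_0) auto
    also have "ennreal (min 1 (2 powr (1 - q)) * (2 * r) powr - m) * ennreal ((r/2) powr p / p) =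
       ennreal (E * ?L)"
      using r assms by (simp add: E_def e_def powr_mult powr_diff powr_minus powr_divide field_simps flip: ennreal_mult)
    finally show "ennreal E * profile (m - p) r \<le> weighted_integral p q m r"
      using E by (simp add: pr ennreal_mult')
  qed
  moreover have "0 < max D (1 / E)" using D by (simp add: less_max_iff_disj)
  ultimately show ?thesis by blast
qed

lemma profile_unbounded:
  assumes "0 \<le> \<delta>"
  shows "\<exists>r\<in>{0<..1}. ennreal z < profile \<delta> r"
proof -
  \<comment> \<open>The profile at \<open>exp (- u)\<close> is at least \<open>u\<close> if \<open>\<delta> = 0\<close>, and at least \<open>1 + \<delta> u\<close> otherwise.\<close>
  define u where "u = (if \<delta> = 0 then 1 else 1 / \<delta>) * (max 0 z + 1)"
  have u: "0 < u" using assms by (auto simp: u_def)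
  have "ennreal z < profile \<delta> (exp (- u))"
  proof (cases "\<delta> = 0")
    case True
    then have "z < max 1 (- ln (exp (- u)))" "0 < max 1 (- ln (exp (- u)))" by (auto simp: u_def)
    then have "ennreal z < ennreal (max 1 (- ln (exp (- u))))" by (intro ennreal_lessI)
    then show ?thesis using True by (simp add: profile_def)
  next
    case False
    have "max 0 z + 1 = \<delta> * u" using False by (simp add: u_def)
    also have "\<dots> < exp (\<delta> * u)" using exp_ge_add_one_self[of "\<delta> * u"] by linarith
    finally show ?thesis using False assms by (auto simp: profile_def powr_def intro!: ennreal_lessI)
  qed
  then show ?thesis using u by (intro bexI[of _ "exp (- u)"]) auto
qed

text \<open>The integral increases as \<open>r\<close> decreases, so at \<open>r = 0\<close> it exceeds every value of an unbounded
  profile.\<close>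

lemma weighted_integral_0:
  assumes "0 \<le> m" "0 \<le> \<delta>" "C > 0"
    and est: "\<forall>r\<in>{0<..1}. within_factor C (weighted_integral p q m r) (profile \<delta> r)"
  shows "weighted_integral p q m 0 = \<infinity>"
proof (rule ccontr)
  assume "weighted_integral p q m 0 \<noteq> \<infinity>"
  then obtain z where z: "weighted_integral p q m 0 = ennreal z" "0 \<le> z"
    by (cases "weighted_integral p q m 0") auto
  obtain r where r: "r \<in> {0<..1}" "ennreal (C * z) < profile \<delta> r"
    using profile_unbounded[OF assms(2)] by blast
  have "within_factor C (profile \<delta> r) (weighted_integral p q m r)"
    using est r assms(3) by (blast intro: within_factor_sym)
  then have "profile \<delta> r \<le> ennreal C * weighted_integral p q m r"
    by (simp add: within_factor_def)
  also have "\<dots> \<le> ennreal C * weighted_integral p q m 0"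
    using r assms by (intro mult_left_mono weighted_integral_antimono) auto
  also have "\<dots> = ennreal (C * z)" using z assms(3) by (simp add: ennreal_mult)
  finally show False using r by simp
qed

lemma weighted_integral_estimate:
  assumes "0 < p" "0 < q" "0 \<le> m"
  shows "\<exists>C>0. \<forall>r\<in>{0..1}. within_factor C (weighted_integral p q m r) (profile (m - p) r)"
proof (cases "m < p")
  case True
  then show ?thesis using weighted_integral_subcritical assms by blast
next
  case False
  then have "\<exists>C>0. \<forall>r\<in>{0<..1}. within_factor C (weighted_integral p q m r) (profile (m - p) r)"
    using weighted_integral_critical_pos[of p q] weighted_integral_supercritical_pos[of p q m] assms
    by (cases "m = p") auto
  then obtain C where C: "C > 0" "\<forall>r\<in>{0<..1}. within_factor C (weighted_integral p q m r) (profile (m - p) r)"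
    by blast
  have "weighted_integral p q m 0 = \<infinity>"
    by (rule weighted_integral_0[OF assms(3) _ C]) (use False in simp)
  moreover have "profile (m - p) 0 = \<infinity>" using False by (simp add: profile_def)
  ultimately have "within_factor C (weighted_integral p q m 0) (profile (m - p) 0)"
    using C(1) by (simp add: within_factor_def ennreal_mult_top)
  then show ?thesis using C by (intro exI[of _ C]) (force simp: less_le)
qed

section \<open>The integral as a function of two squared distances\<close>

text \<open>The kernel integral, with free exponents, in terms of the values \<open>a\<close> and \<open>b\<close> of the
  base at \<open>t = 1\<close> and at \<open>t = -1\<close>.\<close>

definition newton_integral :: "real \<Rightarrow> real \<Rightarrow> real \<Rightarrow> real \<Rightarrow> real \<Rightarrow> ennreal" where
  "newton_integral p q m a b =
     (\<integral>\<^sup>+t\<in>{-1<..<1}. ennreal ((1 - t) powr (p - 1) * (1 + t) powr (q - 1)) /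
        ennreal (((1 + t) / 2 * a + (1 - t) / 2 * b) powr m) \<partial>lborel)"

text \<open>This is the substitution \<open>t \<mapsto> -t\<close>.\<close>

lemma newton_integral_swap: "newton_integral p q m a b = newton_integral q p m b a"
proof -
  have "newton_integral p q m a b = (\<integral>\<^sup>+t. (ennreal ((1 - (0 + (-1) * t)) powr (p - 1) * (1 + (0 + (-1) * t)) powr (q - 1)) /
        ennreal (((1 + (0 + (-1) * t)) / 2 * a + (1 - (0 + (-1) * t)) / 2 * b) powr m)) * indicator {-1<..<1} (0 + (-1) * t) \<partial>lborel)"
    unfolding newton_integral_def by (subst nn_integral_real_affine[where t = 0 and c = "-1"]) auto
  also have "\<dots> = newton_integral q p m b a"
    unfolding newton_integral_def by (intro nn_integral_cong) (auto simp: indicator_def mult.commute add.commute)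
  finally show ?thesis .
qed

text \<open>This is the substitution \<open>t = 1 - 2 s\<close>, after which \<open>b\<close> can be taken out of the base.\<close>

lemma newton_integral_rescale:
  assumes "0 \<le> a" "a \<le> b" "0 < b"
  shows "newton_integral p q m a b =
    ennreal (2 powr (p + q - 1)) * (ennreal (b powr - m) * weighted_integral p q m (a / b))"
proof -
  have "newton_integral p q m a b = ennreal 2 * (\<integral>\<^sup>+s. (ennreal ((1 - (1 + (-2) * s)) powr (p - 1) * (1 + (1 + (-2) * s)) powr (q - 1)) /
        ennreal (((1 + (1 + (-2) * s)) / 2 * a + (1 - (1 + (-2) * s)) / 2 * b) powr m)) * indicator {-1<..<1} (1 + (-2) * s) \<partial>lborel)"
    unfolding newton_integral_def by (subst nn_integral_real_affine[where t = 1 and c = "-2"]) auto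
  also have "(\<integral>\<^sup>+s. (ennreal ((1 - (1 + (-2) * s)) powr (p - 1) * (1 + (1 + (-2) * s)) powr (q - 1)) /
        ennreal (((1 + (1 + (-2) * s)) / 2 * a + (1 - (1 + (-2) * s)) / 2 * b) powr m)) * indicator {-1<..<1} (1 + (-2) * s) \<partial>lborel)
     = (\<integral>\<^sup>+s. ennreal (2 powr (p + q - 2) * b powr - m) * (ennreal (s powr (p - 1) * (1 - s) powr (q - 1) *
        (a / b + (1 - a / b) * s) powr - m) * indicator {0<..<1} s) \<partial>lborel)"
  proof (intro nn_integral_cong)
    fix s :: real
    show "(ennreal ((1 - (1 + (-2) * s)) powr (p - 1) * (1 + (1 + (-2) * s)) powr (q - 1)) /
        ennreal (((1 + (1 + (-2) * s)) / 2 * a + (1 - (1 + (-2) * s)) / 2 * b) powr m)) * indicator {-1<..<1} (1 + (-2) * s)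
      = ennreal (2 powr (p + q - 2) * b powr - m) * (ennreal (s powr (p - 1) * (1 - s) powr (q - 1) *
        (a / b + (1 - a / b) * s) powr - m) * indicator {0<..<1} s)"
    proof (cases "s \<in> {0<..<1}")
      case True
      then have s: "0 < s" "s < 1" by auto
      define D where "D = a / b + (1 - a / b) * s"
      have D: "0 < D"
        using base_bounds(2)[of "a / b" s] s assms unfolding D_def by simp
      have base: "(1 + (1 + (-2) * s)) / 2 * a + (1 - (1 + (-2) * s)) / 2 * b = b * D"
        using assms by (simp add: D_def field_simps)
      have "1 - (1 + (-2) * s) = 2 * s" "1 + (1 + (-2) * s) = 2 * (1 - s)" by auto
      then have num: "(1 - (1 + (-2) * s)) powr (p - 1) * (1 + (1 + (-2) * s)) powr (q - 1)
          = 2 powr (p + q - 2) * (s powr (p - 1) * (1 - s) powr (q - 1))"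
        using s powr_add[of 2 "p - 1" "q - 1"] by (simp only: powr_mult) (simp add: algebra_simps)
      show ?thesis
        unfolding base num D_def[symmetric] using True assms D
        by (simp add: divide_ennreal powr_mult powr_minus field_simps flip: ennreal_mult)
    qed (auto simp: indicator_def)
  qed
  also have "\<dots> = ennreal (2 powr (p + q - 2) * b powr - m) * weighted_integral p q m (a / b)"
    unfolding weighted_integral_def by (simp add: nn_integral_cmult)
  also have "ennreal 2 * \<dots> = ennreal (2 * 2 powr (p + q - 2)) * (ennreal (b powr - m) * weighted_integral p q m (a / b))"
    by (simp add: ennreal_mult mult.assoc)
  also have "2 * 2 powr (p + q - 2) = (2::real) powr (p + q - 1)"
    by (simp add: powr_diff)
  finally show ?thesis .
qed

lemma newton_integral_0_0: "newton_integral p q m 0 0 = \<infinity>"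
proof -
  have "newton_integral p q m 0 0 = (\<integral>\<^sup>+t. \<infinity> * indicator {-1<..<1::real} t \<partial>lborel)"
    unfolding newton_integral_def
    by (intro nn_integral_cong) (auto simp: indicator_def ennreal_divide_eq_top_iff)
  also have "\<dots> = \<infinity>"
    by (subst nn_integral_cmult_indicator) (auto simp: ennreal_top_mult)
  finally show ?thesis .
qed

lemma newton_integral_estimate:
  assumes "0 < p" "0 < q" "0 \<le> m"
  shows "\<exists>C>0. \<forall>a b. 0 \<le> a \<and> a \<le> b \<and> 0 < b \<longrightarrow>
    within_factor C (newton_integral p q m a b) (ennreal (b powr - m) * profile (m - p) (a / b))"
proof -
  obtain C where C: "C > 0" "\<forall>r\<in>{0..1}. within_factor C (weighted_integral p q m r) (profile (m - p) r)"
    using weighted_integral_estimate[OF assms] by blast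
  define c where "c = (2::real) powr (p + q - 1)"
  have c: "0 < c" "0 < max c (1 / c)" by (auto simp: c_def less_max_iff_disj)
  have "within_factor (max c (1 / c) * C) (newton_integral p q m a b) (ennreal (b powr - m) * profile (m - p) (a / b))"
    if "0 \<le> a" "a \<le> b" "0 < b" for a b
    unfolding newton_integral_rescale[OF that] c_def[symmetric]
    by (rule within_factor_trans[OF within_factor_scaled[OF c(1)] within_factor_mult c(2) C(1)])
       (use that C(2) in \<open>auto simp: field_simps\<close>)
  then show ?thesis using C(1) c(2) by (intro exI[of _ "max c (1 / c) * C"]) auto
qed

text \<open>To identify the size of the integral it is enough to compare the candidate \<open>g\<close> with the profile of
  the exponent \<open>p\<close> where \<open>a \<le> b\<close> and with that of the exponent \<open>q\<close> where \<open>b \<le> a\<close>. At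
  \<open>a = b = 0\<close> the integrand is infinite everywhere.\<close>

lemma newton_integral_comparable:
  assumes "0 < p" "0 < q" "0 \<le> m" "0 < D"
    and ab: "\<And>a b. 0 \<le> a \<Longrightarrow> a \<le> b \<Longrightarrow> 0 < b \<Longrightarrow>
      within_factor D (ennreal (b powr - m) * profile (m - p) (a / b)) (g a b)"
    and ba: "\<And>a b. 0 \<le> b \<Longrightarrow> b \<le> a \<Longrightarrow> 0 < a \<Longrightarrow>
      within_factor D (ennreal (a powr - m) * profile (m - q) (b / a)) (g a b)"
    and "g 0 0 = \<infinity>"
  shows "\<exists>C>0. \<forall>a\<ge>0. \<forall>b\<ge>0. within_factor C (newton_integral p q m a b) (g a b)"
proof -
  obtain C1 where C1: "C1 > 0" "\<forall>a b. 0 \<le> a \<and> a \<le> b \<and> 0 < b \<longrightarrow>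
    within_factor C1 (newton_integral p q m a b) (ennreal (b powr - m) * profile (m - p) (a / b))"
    using newton_integral_estimate[OF assms(1,2,3)] by blast
  obtain C2 where C2: "C2 > 0" "\<forall>a b. 0 \<le> a \<and> a \<le> b \<and> 0 < b \<longrightarrow>
    within_factor C2 (newton_integral q p m a b) (ennreal (b powr - m) * profile (m - q) (a / b))"
    using newton_integral_estimate[OF assms(2,1,3)] by blast
  define C where "C = max C1 C2 * D"
  have "within_factor C (newton_integral p q m a b) (g a b)" if "0 \<le> a" "0 \<le> b" for a b
  proof -
    consider "a \<le> b" "0 < b" | "b \<le> a" "0 < a" | "a = 0" "b = 0"
      using \<open>0 \<le> a\<close> \<open>0 \<le> b\<close> by linarith
    then show ?thesis
    proof cases
      case 1
      then have "within_factor (C1 * D) (newton_integral p q m a b) (g a b)"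
        using C1 that assms(4) by (intro within_factor_trans[OF _ ab]) auto
      then show ?thesis
        by (rule within_factor_mono) (use C1(1) assms(4) in \<open>auto simp: C_def\<close>)
    next
      case 2
      then have "within_factor (C2 * D) (newton_integral p q m a b) (g a b)"
        unfolding newton_integral_swap[of p q]
        using C2 that assms(4) by (intro within_factor_trans[OF _ ba]) auto
      then show ?thesis
        by (rule within_factor_mono) (use C2(1) assms(4) in \<open>auto simp: C_def\<close>)
    next
      case 3
      then show ?thesis using C1 assms(4,7) newton_integral_0_0
        by (auto simp: within_factor_def C_def ennreal_mult_top less_max_iff_disj)
    qed
  qed
  moreover have "C > 0" using C1 assms(4) by (simp add: C_def less_max_iff_disj)
  ultimately show ?thesis by blast
qed

section \<open>The profiles in the form of the four bounds\<close>

lemma profile_pos_eq: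
  assumes "0 \<le> a" "0 < b" "0 < \<delta>"
  shows "ennreal (b powr - m) * profile \<delta> (a / b) = 1 / ennreal (b powr (m - \<delta>) * a powr \<delta>)"
proof (cases "a = 0")
  case True
  then show ?thesis using assms by (simp add: profile_def ennreal_mult_top)
next
  case False
  have "1 / ennreal (b powr (m - \<delta>) * a powr \<delta>) = ennreal (1 / (b powr (m - \<delta>) * a powr \<delta>))"
    using False assms by (subst divide_ennreal[symmetric]) auto
  also have "1 / (b powr (m - \<delta>) * a powr \<delta>) = b powr - m * (a / b) powr - \<delta>"
    using False assms by (simp add: powr_diff powr_minus powr_divide field_simps)
  finally show ?thesis using False assms by (simp add: profile_def ennreal_mult)
qed

lemma profile_neg_eq:
  assumes "0 < b" "\<delta> < 0"
  shows "ennreal (b powr - m) * profile \<delta> r = 1 / ennreal (b powr m)"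
proof -
  have "1 / ennreal (b powr m) = ennreal (1 / b powr m)"
    using assms by (subst divide_ennreal[symmetric]) auto
  then show ?thesis using assms by (simp add: profile_def powr_minus_divide)
qed

lemma log_bracket_eq:
  assumes "0 \<le> x" "0 < y"
  shows "log_bracket x y = ennreal (max 1 (ln (x / y)))"
proof (cases "x = 0")
  case True
  then show ?thesis using assms by (simp add: log_bracket_def ext_log_def one_ereal_def max_def)
next
  case False
  have "max 1 (ereal (ln (x / y))) = ereal (max 1 (ln (x / y)))"
    by (simp add: one_ereal_def max_def)
  then have "e2ennreal (max 1 (ereal (ln (x / y)))) = ennreal (max 1 (ln (x / y)))"
    by (simp only: e2ennreal_ereal)
  then show ?thesis using assms False
    by (simp add: log_bracket_def ext_log_def divide_ennreal)
qed

lemma log_bracket_0_right: "0 < x \<Longrightarrow> log_bracket x 0 = \<infinity>"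
  by (simp add: log_bracket_def ext_log_def ennreal_divide_eq_top_iff max_def)

lemma log_bracket_small:
  assumes "0 \<le> x" "x \<le> y" "0 < y"
  shows "log_bracket x y = 1"
proof -
  have "ln (x / y) \<le> 1"
  proof (cases "x = 0")
    case False
    then have "ln (x / y) \<le> ln 1" using assms by (subst ln_le_cancel_iff) auto
    then show ?thesis by simp
  qed simp
  then show ?thesis using assms by (simp add: log_bracket_eq max_def)
qed

text \<open>With \<open>R = b / a \<ge> 1\<close>, the two sides are \<open>max 1 (log R)\<close> and \<open>max 1 (log ((R - 1) / 4))\<close>. For
  \<open>R \<ge> 2\<close> the arguments of the logarithms differ by a factor of at most 8, and \<open>log 8 < 3\<close>; for
  \<open>R \<le> 2\<close> both maxima are 1. If \<open>a = 0\<close>, both sides are infinite.\<close>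

lemma profile_0_log_bracket:
  assumes "0 \<le> a" "a \<le> b" "0 < b"
  shows "within_factor 4 (profile 0 (a / b)) (log_bracket (\<bar>b - a\<bar> / 4) a)"
proof (cases "a = 0")
  case True
  then show ?thesis using assms
    by (simp add: profile_def log_bracket_0_right within_factor_def ennreal_mult_top)
next
  case False
  then have a: "0 < a" using assms by simp
  define R where "R = b / a"
  have R: "1 \<le> R" using a assms by (simp add: R_def)
  have e: "- ln (a / b) = ln R" using a assms by (simp add: R_def ln_div)
  have f: "\<bar>b - a\<bar> / 4 / a = (R - 1) / 4" using a assms by (simp add: R_def field_simps)
  define L where "L = max 1 (ln R)"
  define G where "G = max 1 (ln ((R - 1) / 4))"
  have "ln ((R - 1) / 4) \<le> ln R"
    using R by (cases "R = 1") auto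
  then have "G \<le> L" by (auto simp: G_def L_def)
  have "ln R \<le> 4 * G"
  proof (cases "R \<le> 2")
    case True
    then have "ln R \<le> R - 1" using R by (intro ln_le_minus_one) auto
    then show ?thesis using True by (auto simp: G_def)
  next
    case False
    have "ln R \<le> ln (8 * ((R - 1) / 4))" using False by (subst ln_le_cancel_iff) auto
    also have "\<dots> = ln 8 + ln ((R - 1) / 4)" using False by (subst ln_mult) auto
    also have "ln 8 = 3 * ln (2::real)" using ln_realpow[of "2::real" 3] by simp
    also have "3 * ln 2 \<le> (3::real)" using ln_le_minus_one[of "2::real"] by simp
    finally show ?thesis by (auto simp: G_def)
  qed
  then have "L \<le> 4 * G" by (auto simp: L_def G_def)
  have "profile 0 (a / b) = ennreal L" using a assms e by (simp add: profile_def L_def)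
  moreover have "log_bracket (\<bar>b - a\<bar> / 4) a = ennreal G"
    using a by (subst log_bracket_eq) (auto simp only: f G_def, simp_all)
  moreover have "1 / 4 * G \<le> L" using \<open>G \<le> L\<close> by (auto simp: G_def L_def)
  ultimately show ?thesis using ennreal_leI[OF \<open>L \<le> 4 * G\<close>]
    unfolding within_factor_def by (auto intro: ennreal_leI simp: ennreal_mult' simp flip: ennreal_mult'[of "1/4"])
qed

lemma profile_0_bracket_scaled:
  assumes "0 \<le> a" "a \<le> b" "0 < b"
  shows "within_factor 4 (ennreal (b powr - m) * profile 0 (a / b))
    (1 / ennreal (b powr m) * log_bracket (\<bar>b - a\<bar> / 4) a)"
proof -
  have "1 / ennreal (b powr m) = ennreal (b powr - m)"
    using assms profile_neg_eq[of b "-1" m 0] by (simp add: profile_def)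
  then show ?thesis using profile_0_log_bracket[OF assms] by (simp add: within_factor_mult)
qed

lemma within_factor_eq: "f = g \<Longrightarrow> 1 \<le> C \<Longrightarrow> within_factor C f g"
  using within_factor_mono[OF within_factor_refl] by auto

text \<open>Here \<open>m = p\<close> where \<open>a \<le> b\<close>, and \<open>m < q\<close> where \<open>b \<le> a\<close>: only small \<open>|x - y|\<close> produces a
  logarithm.\<close>

lemma newton_integral_dim2:
  assumes "0 < k"
  shows "\<exists>C>0. \<forall>a\<ge>0. \<forall>b\<ge>0. within_factor C (newton_integral k (k + 1) k a b)
    (1 / ennreal (max a b powr k) * log_bracket (\<bar>b - a\<bar> / 4) a)"
proof (rule newton_integral_comparable[where D = 4])
  fix a b :: real assume h: "0 \<le> a" "a \<le> b" "0 < b"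
  then show "within_factor 4 (ennreal (b powr - k) * profile (k - k) (a / b))
    (1 / ennreal (max a b powr k) * log_bracket (\<bar>b - a\<bar> / 4) a)"
    using profile_0_bracket_scaled[OF h, of k] by (simp add: max_absorb2)
next
  fix a b :: real assume h: "0 \<le> b" "b \<le> a" "0 < a"
  then show "within_factor 4 (ennreal (a powr - k) * profile (k - (k + 1)) (b / a))
    (1 / ennreal (max a b powr k) * log_bracket (\<bar>b - a\<bar> / 4) a)"
    by (intro within_factor_eq) (simp_all add: profile_neg_eq log_bracket_small max_absorb1)
qed (use assms in \<open>auto simp: log_bracket_def\<close>)

text \<open>Here \<open>p < m < q\<close>, and there is no logarithm: the integral is a negative
  power of the ratio where \<open>a \<le> b\<close>, and of constant size relative to \<open>a\<^sup>-\<^sup>m\<close> where \<open>b \<le> a\<close>.\<close>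

lemma newton_integral_dim3:
  assumes "0 < k"
  shows "\<exists>C>0. \<forall>a\<ge>0. \<forall>b\<ge>0. within_factor C (newton_integral k (k + 1) (k + 1/2) a b)
    (1 / ennreal (max a b powr k * sqrt a))"
proof (rule newton_integral_comparable[where D = 1])
  fix a b :: real assume h: "0 \<le> a" "a \<le> b" "0 < b"
  then show "within_factor 1 (ennreal (b powr - (k + 1/2)) * profile (k + 1/2 - k) (a / b))
    (1 / ennreal (max a b powr k * sqrt a))"
    by (intro within_factor_eq) (simp_all add: profile_pos_eq powr_half_sqrt max_absorb2 del: minus_add_distrib)
next
  fix a b :: real assume h: "0 \<le> b" "b \<le> a" "0 < a"
  then have "a powr (k + 1/2) = max a b powr k * sqrt a"
    by (simp add: powr_add powr_half_sqrt max_absorb1)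
  then show "within_factor 1 (ennreal (a powr - (k + 1/2)) * profile (k + 1/2 - (k + 1)) (b / a))
    (1 / ennreal (max a b powr k * sqrt a))"
    using h profile_neg_eq[of a "k + 1/2 - (k + 1)" "k + 1/2" "b/a"] by (intro within_factor_eq) simp_all
qed (use assms in auto)

text \<open>Here \<open>m = q\<close>, so the logarithm now comes from small \<open>|x - \<sigma> y|\<close>.\<close>

lemma newton_integral_dim4:
  assumes "0 < k"
  shows "\<exists>C>0. \<forall>a\<ge>0. \<forall>b\<ge>0. within_factor C (newton_integral k (k + 1) (k + 1) a b)
    (1 / ennreal (max a b powr k * a) * log_bracket (\<bar>b - a\<bar> / 4) b)"
proof (rule newton_integral_comparable[where D = 4])
  fix a b :: real assume h: "0 \<le> a" "a \<le> b" "0 < b"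
  then show "within_factor 4 (ennreal (b powr - (k + 1)) * profile (k + 1 - k) (a / b))
    (1 / ennreal (max a b powr k * a) * log_bracket (\<bar>b - a\<bar> / 4) b)"
    using profile_pos_eq[of a b 1 "k + 1"]
    by (intro within_factor_eq) (simp_all add: log_bracket_small max_absorb2)
next
  fix a b :: real assume h: "0 \<le> b" "b \<le> a" "0 < a"
  then have "a powr (k + 1) = max a b powr k * a"
    by (simp add: powr_add max_absorb1)
  then show "within_factor 4 (ennreal (a powr - (k + 1)) * profile (k + 1 - (k + 1)) (b / a))
    (1 / ennreal (max a b powr k * a) * log_bracket (\<bar>b - a\<bar> / 4) b)"
    using profile_0_bracket_scaled[OF h, of "k + 1"] by (simp add: abs_minus_commute)
qed (use assms in \<open>auto simp: log_bracket_def\<close>)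

lemma sqrt_power_eq_powr: "0 \<le> a \<Longrightarrow> 0 < n \<Longrightarrow> sqrt a ^ n = a powr (real n / 2)"
  by (cases "a = 0") (simp_all add: powr_half_sqrt[symmetric] powr_powr powr_realpow[symmetric])

text \<open>With \<open>n = d - 4\<close>, both \<open>m - p = 1 + n/2\<close> and \<open>m - q = n/2\<close> are positive, so the integral has the size of
  \<open>1 / (b\<^sup>k a a\<^sup>n\<^sup>/\<^sup>2)\<close> where \<open>a \<le> b\<close> and of \<open>1 / (a\<^sup>k a b\<^sup>n\<^sup>/\<^sup>2)\<close> where \<open>b \<le> a\<close>. In both cases the
  last factor is a power of the smaller of the two.\<close>

lemma newton_integral_dim_ge5:
  assumes "0 < k" "0 < n"
  shows "\<exists>C>0. \<forall>a\<ge>0. \<forall>b\<ge>0. within_factor C (newton_integral k (k + 1) (k + 1 + real n / 2) a b)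
    (1 / ennreal (max a b powr k * a * sqrt (min a b) ^ n))"
proof (rule newton_integral_comparable[where D = 1])
  fix a b :: real assume h: "0 \<le> a" "a \<le> b" "0 < b"
  have "ennreal (b powr - (k + 1 + real n / 2)) * profile (1 + real n / 2) (a / b)
      = 1 / ennreal (b powr (k + 1 + real n / 2 - (1 + real n / 2)) * a powr (1 + real n / 2))"
    using h assms by (intro profile_pos_eq) (auto simp: add_pos_pos)
  moreover have "b powr (k + 1 + real n / 2 - (1 + real n / 2)) * a powr (1 + real n / 2)
      = max a b powr k * a * sqrt (min a b) ^ n"
    using h assms by (simp add: powr_add sqrt_power_eq_powr)
  ultimately show "within_factor 1 (ennreal (b powr - (k + 1 + real n / 2)) * profile (k + 1 + real n / 2 - k) (a / b))
    (1 / ennreal (max a b powr k * a * sqrt (min a b) ^ n))"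
    by (intro within_factor_eq) (simp_all add: add.commute add.left_commute)
next
  fix a b :: real assume h: "0 \<le> b" "b \<le> a" "0 < a"
  have "ennreal (a powr - (k + 1 + real n / 2)) * profile (real n / 2) (b / a)
      = 1 / ennreal (a powr (k + 1 + real n / 2 - real n / 2) * b powr (real n / 2))"
    using h assms by (intro profile_pos_eq) auto
  moreover have "a powr (k + 1 + real n / 2 - real n / 2) * b powr (real n / 2)
      = max a b powr k * a * sqrt (min a b) ^ n"
    using h assms by (simp add: powr_add sqrt_power_eq_powr)
  ultimately show "within_factor 1 (ennreal (a powr - (k + 1 + real n / 2)) * profile (k + 1 + real n / 2 - (k + 1)) (b / a))
    (1 / ennreal (max a b powr k * a * sqrt (min a b) ^ n))"
    by (intro within_factor_eq) simp_all
qed (use assms in auto)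

section \<open>Positivity of the normalising constant\<close>

lemma space_sphere_measure: "space (sphere_measure :: 'a::euclidean_space measure) = sphere 0 1"
  by (simp add: sphere_measure_def space_scale_measure space_restrict_space)

lemma sets_sphere_measure:
  "sets (sphere_measure :: 'a::euclidean_space measure) = sets (restrict_space borel (sphere 0 1))"
  by (simp add: sphere_measure_def)

text \<open>The total mass is a multiple of the volume of a subset of the unit ball.\<close>

lemma finite_sphere_measure: "finite_measure (sphere_measure :: 'a::euclidean_space measure)"
proof
  let ?cone = "{t *\<^sub>R u | t u. 0 < t \<and> t \<le> 1 \<and> u \<in> sphere (0::'a) 1}"
  have "?cone \<subseteq> cball 0 1" by auto
  then have "emeasure lborel ?cone \<le> emeasure lborel (cball (0::'a) 1)"
    by (intro emeasure_mono) auto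
  also have "\<dots> < \<infinity>" using emeasure_bounded_finite[of "cball (0::'a) 1"] by (simp add: bounded_cball)
  finally show "emeasure sphere_measure (space (sphere_measure :: 'a measure)) \<noteq> \<infinity>"
    unfolding space_sphere_measure
    by (subst emeasure_sphere_measure) (auto simp: ennreal_mult_eq_top_iff)
qed

text \<open>The integrand is bounded, hence integrable, and it vanishes only on the hyperplane \<open>x\<^sub>1 = 0\<close>. If the
  integral were 0, then the cone over the rest of the sphere would be a null set, but this cone
  contains a nonempty open set. Integrability matters, as the integral of a function that is not
  integrable is 0 by convention.\<close>

lemma d_const_pos:
  fixes i :: "'n::finite"
  assumes "0 < k"
  shows "0 < d_const i k"
proof -
  let ?M = "sphere_measure :: (real ^ 'n) measure"
  let ?f = "\<lambda>x :: real ^ 'n. \<bar>root_vec i \<bullet> x\<bar> powr (2 * k)"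
  interpret finite_measure ?M by (rule finite_sphere_measure)
  have root: "root_vec i \<bullet> x = sqrt 2 * x $ i" for x :: "real ^ 'n"
    by (simp add: root_vec_def inner_axis' )
  have "?f \<in> borel_measurable (restrict_space borel (sphere 0 1))"
    by (intro measurable_restrict_space1) measurable
  then have meas [measurable]: "?f \<in> borel_measurable ?M"
    using measurable_cong_sets[OF sets_sphere_measure refl] by blast
  have int: "integrable ?M ?f"
  proof (rule integrable_const_bound[where B = "sqrt 2 powr (2 * k)"])
    have "?f x \<le> sqrt 2 powr (2 * k)" if "x \<in> sphere 0 1" for x
    proof (intro powr_mono2)
      show "\<bar>root_vec i \<bullet> x\<bar> \<le> sqrt 2"
        using component_le_norm_cart[of x i] that by (simp add: root abs_mult)
    qed (use assms in auto)
    then show "AE x in ?M. norm (?f x) \<le> sqrt 2 powr (2 * k)"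
      by (intro AE_I2) (auto simp: space_sphere_measure)
  qed (rule meas)
  have "\<not> (AE x in ?M. ?f x = 0)"
  proof
    assume "AE x in ?M. ?f x = 0"
    then have "AE x in ?M. x $ i = 0" by (simp add: root)
    let ?A = "{x \<in> sphere 0 1. (x :: real ^ 'n) $ i \<noteq> 0}"
    let ?U = "{x \<in> ball 0 1. (x :: real ^ 'n) $ i \<noteq> 0}"
    have A: "?A \<in> sets borel" by measurable
    have A': "?A \<in> sets ?M"
      using A by (subst sets_sphere_measure, subst sets_restrict_space_iff) auto
    have "{x \<in> space ?M. \<not> x $ i = 0} = ?A" by (simp add: space_sphere_measure)
    from AE_iff_measurable[OF A' this] have "emeasure ?M ?A = 0"
      using \<open>AE x in ?M. x $ i = 0\<close> by (rule iffD1)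
    then have cone: "emeasure lborel {t *\<^sub>R u | t u. 0 < t \<and> t \<le> 1 \<and> u \<in> ?A} = 0"
    proof -
      have "?A \<subseteq> sphere 0 1" by blast
      from emeasure_sphere_measure[OF A this] \<open>emeasure ?M ?A = 0\<close> show ?thesis by simp
    qed
    have U: "open ?U"
    proof -
      have "?U = ball 0 1 \<inter> {x. x $ i \<noteq> 0}" by auto
      moreover have "open {x :: real ^ 'n. x $ i \<noteq> 0}"
        by (intro open_Collect_neq continuous_intros)
      ultimately show ?thesis by auto
    qed
    have "{t *\<^sub>R u | t u. 0 < t \<and> t \<le> 1 \<and> u \<in> ?A} = {x \<in> cball 0 1. x $ i \<noteq> 0}" (is "?L = ?R")
    proof
      show "?L \<subseteq> ?R" by auto
      show "?R \<subseteq> ?L"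
      proof
        fix x assume x: "x \<in> ?R"
        then have "x \<noteq> 0" by auto
        then show "x \<in> ?L"
          using x by (auto intro!: exI[of _ "norm x"] exI[of _ "x /\<^sub>R norm x"])
      qed
    qed
    with cone have "emeasure lborel ?R = 0" by simp
    moreover have "emeasure lborel ?U \<le> emeasure lborel ?R"
      by (intro emeasure_mono) auto
    ultimately have "emeasure lborel ?U = 0"
      by simp
    then have "?U \<in> null_sets lborel" using U by (auto intro: null_setsI)
    then have "negligible ?U"
      using negligible_iff_null_sets null_sets_completionI by blast
    then have "?U = {}" using open_not_negligible[OF U] by blast
    moreover have "(1/2) *\<^sub>R axis i 1 \<in> ?U" by (simp add: norm_axis_1)
    ultimately show False by blast
  qed
  then have "d_const i k \<noteq> 0"
    unfolding d_const_def by (subst integral_nonneg_eq_0_iff_AE[OF int]) auto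
  moreover have "0 \<le> d_const i k"
    unfolding d_const_def by (intro integral_nonneg_AE) auto
  ultimately show ?thesis by simp
qed

section \<open>The Newton kernel\<close>

text \<open>The values of the base in the kernel at \<open>t = 1\<close> and at \<open>t = -1\<close>.\<close>

lemma
  fixes x y :: "real ^ 'n::finite"
  shows norm_diff_eq_split: "(norm (x - y))\<^sup>2 = (norm x)\<^sup>2 + (norm y)\<^sup>2 - 2 * (x $ i * y $ i + (\<Sum>j\<in>UNIV - {i}. x $ j * y $ j))"
    and norm_diff_reflect_eq_split: "(norm (x - reflect i y))\<^sup>2 = (norm x)\<^sup>2 + (norm y)\<^sup>2 - 2 * (- (x $ i * y $ i) + (\<Sum>j\<in>UNIV - {i}. x $ j * y $ j))"
proof -
  have inner: "x \<bullet> z = x $ i * z $ i + (\<Sum>j\<in>UNIV - {i}. x $ j * z $ j)" for z :: "real ^ 'n"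
    by (simp add: inner_vec_def sum.remove[of _ i])
  have refl: "x \<bullet> reflect i y = - (x $ i * y $ i) + (\<Sum>j\<in>UNIV - {i}. x $ j * y $ j)"
    unfolding inner by (auto simp: reflect_def intro!: sum.cong)
  have "norm (reflect i y) = norm y"
    unfolding norm_vec_def by (intro L2_set_cong) (auto simp: reflect_def)
  moreover have "(norm (x - z))\<^sup>2 = (norm x)\<^sup>2 + (norm z)\<^sup>2 - 2 * (x \<bullet> z)" for z
    unfolding power2_norm_eq_inner by (simp add: inner_diff inner_commute)
  ultimately show "(norm (x - y))\<^sup>2 = (norm x)\<^sup>2 + (norm y)\<^sup>2 - 2 * (x $ i * y $ i + (\<Sum>j\<in>UNIV - {i}. x $ j * y $ j))"
    "(norm (x - reflect i y))\<^sup>2 = (norm x)\<^sup>2 + (norm y)\<^sup>2 - 2 * (- (x $ i * y $ i) + (\<Sum>j\<in>UNIV - {i}. x $ j * y $ j))"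
    using inner refl by simp_all
qed

lemma norm_diff_reflect_diff:
  fixes x y :: "real ^ 'n::finite"
  shows "\<bar>(norm (x - reflect i y))\<^sup>2 - (norm (x - y))\<^sup>2\<bar> / 4 = \<bar>x $ i * y $ i\<bar>"
proof -
  have "(norm (x - reflect i y))\<^sup>2 - (norm (x - y))\<^sup>2 = 4 * (x $ i * y $ i)"
    unfolding norm_diff_eq_split[of x y i] norm_diff_reflect_eq_split by (simp add: algebra_simps)
  then show ?thesis by (simp add: abs_mult)
qed

lemma newton_kernel_eq:
  fixes x y :: "real ^ 'n::finite"
  shows "newton_kernel i k x y = ennreal (c_const k * C_const i k) *
    newton_integral k (k + 1) (k + real CARD('n) / 2 - 1) ((norm (x - y))\<^sup>2) ((norm (x - reflect i y))\<^sup>2)"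
proof -
  have "(norm x)\<^sup>2 + (norm y)\<^sup>2 - 2 * (t * (x $ i) * (y $ i) + (\<Sum>j\<in>UNIV - {i}. (x $ j) * (y $ j)))
     = (1 + t) / 2 * (norm (x - y))\<^sup>2 + (1 - t) / 2 * (norm (x - reflect i y))\<^sup>2" for t
    unfolding norm_diff_eq_split[of x y i] norm_diff_reflect_eq_split by (simp add: field_simps)
  then show ?thesis
    unfolding newton_kernel_def newton_integral_def by simp
qed

lemma kernel_constant_pos:
  fixes i :: "'n::finite"
  assumes "CARD('n) \<ge> 2" "0 < k"
  shows "0 < c_const k * C_const i k"
proof (rule mult_pos_pos)
  have "0 < real CARD('n) + 2 * k - 2" using assms by linarith
  then show "0 < C_const i k" using d_const_pos[OF assms(2), of i] by (simp add: C_const_def)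
  show "0 < c_const k" using assms(2) by (simp add: c_const_def Gamma_real_pos)
qed

text \<open>The normalising constant is positive for each choice of the coordinate; since there are finitely many
  coordinates, one comparison constant serves for all of them.\<close>

lemma newton_kernel_comparable:
  fixes k :: real
  assumes "CARD('n::finite) \<ge> 2" "0 < k"
    and "\<exists>C>0. \<forall>a\<ge>0. \<forall>b\<ge>0.
      within_factor C (newton_integral k (k + 1) (k + real CARD('n) / 2 - 1) a b) (g a b)"
  shows "\<exists>C>0. \<forall>i::'n. comparable_with C (newton_kernel i k)
     (\<lambda>x y. g ((norm (x - y))\<^sup>2) ((norm (x - reflect i y))\<^sup>2))"
proof -
  obtain C where C: "C > 0" "\<forall>a\<ge>0. \<forall>b\<ge>0.
      within_factor C (newton_integral k (k + 1) (k + real CARD('n) / 2 - 1) a b) (g a b)"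
    using assms(3) by blast
  define w where "w i = c_const k * C_const i k" for i :: 'n
  define v where "v i = max (w i) (1 / w i)" for i :: 'n
  have w: "0 < w i" for i using kernel_constant_pos[OF assms(1,2)] by (simp add: w_def)
  have v: "0 < v i" for i using w[of i] by (simp add: v_def less_max_iff_disj)
  define K where "K = sum v UNIV"
  have K: "v i \<le> K" for i unfolding K_def by (rule member_le_sum) (use v in \<open>auto intro: less_imp_le\<close>)
  have "within_factor (K * C) (newton_kernel i k x y) (g ((norm (x - y))\<^sup>2) ((norm (x - reflect i y))\<^sup>2))"
    for i and x y :: "real ^ 'n"
  proof (rule within_factor_mono)
    show "within_factor (v i * C) (newton_kernel i k x y) (g ((norm (x - y))\<^sup>2) ((norm (x - reflect i y))\<^sup>2))"
      unfolding newton_kernel_eq w_def[symmetric] v_def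
      by (rule within_factor_trans[OF within_factor_scaled[OF w] _ _ C(1)])
         (use C(2) v[of i] in \<open>auto simp: v_def\<close>)
  qed (use v[of i] K[of i] C(1) in auto)
  moreover have "0 < K * C" using K v C(1) less_le_trans by (metis mult_pos_pos)
  ultimately show ?thesis
    unfolding comparable_with_def within_factor_def by blast
qed

lemma Phi_powr:
  "Phi i x y powr (2 * k) = max ((norm (x - y))\<^sup>2) ((norm (x - reflect i y))\<^sup>2) powr k"
proof -
  let ?P = "max (norm (x - y)) (norm (x - reflect i y))"
  have "max ((norm (x - y))\<^sup>2) ((norm (x - reflect i y))\<^sup>2) = ?P\<^sup>2"
    by (auto simp: max_def power2_le_iff_abs_le)
  moreover have "?P powr (2 * k) = (?P\<^sup>2) powr k"
  proof (cases "?P = 0")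
    case False
    then have "0 < ?P" by (simp add: less_le max_def)
    then show ?thesis by (simp add: powr_powr flip: powr_numeral)
  qed simp
  ultimately show ?thesis by (simp add: Phi_def)
qed

theorem theorem5p1:
  fixes k :: real
  assumes "CARD('n::finite) \<ge> 2" and "k > 0"
  shows "\<exists>C>0. \<forall>i::'n.
    (CARD('n) = 2 \<longrightarrow>
       comparable_with C (newton_kernel i k)
         (\<lambda>x y. 1 / ennreal (Phi i x y powr (2 * k))
            * log_bracket \<bar>x $ i * y $ i\<bar> ((norm (x - y))\<^sup>2))) \<and>
    (CARD('n) = 3 \<longrightarrow>
       comparable_with C (newton_kernel i k)
         (\<lambda>x y. 1 / ennreal (Phi i x y powr (2 * k) * norm (x - y)))) \<and>
    (CARD('n) = 4 \<longrightarrow>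
       comparable_with C (newton_kernel i k)
         (\<lambda>x y. 1 / ennreal (Phi i x y powr (2 * k) * (norm (x - y))\<^sup>2)
            * log_bracket \<bar>x $ i * y $ i\<bar> ((norm (x - reflect i y))\<^sup>2))) \<and>
    (CARD('n) \<ge> 5 \<longrightarrow>
       comparable_with C (newton_kernel i k)
         (\<lambda>x y. 1 / ennreal (Phi i x y powr (2 * k) * (norm (x - y))\<^sup>2
            * (min (norm (x - y)) (norm (x - reflect i y))) ^ (CARD('n) - 4))))"
proof -
  note comparable = newton_kernel_comparable[OF assms]
  consider "CARD('n) = 2" | "CARD('n) = 3" | "CARD('n) = 4" | "CARD('n) \<ge> 5"
    using assms(1) by linarith
  then show ?thesis
  proof cases
    case 1
    show ?thesis
      using comparable[of "\<lambda>a b. 1 / ennreal (max a b powr k) * log_bracket (\<bar>b - a\<bar> / 4) a"]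
        newton_integral_dim2[OF assms(2)] 1
      by (simp add: Phi_powr norm_diff_reflect_diff)
  next
    case 2
    have e: "k + 3 / 2 - 1 = k + 1 / 2" by simp
    show ?thesis
      using comparable[of "\<lambda>a b. 1 / ennreal (max a b powr k * sqrt a)"]
        newton_integral_dim3[OF assms(2)] 2
      by (simp add: Phi_powr e)
  next
    case 3
    have e: "k + 4 / 2 - 1 = k + 1" by simp
    show ?thesis
      using comparable[of "\<lambda>a b. 1 / ennreal (max a b powr k * a) * log_bracket (\<bar>b - a\<bar> / 4) b"]
        newton_integral_dim4[OF assms(2)]
      unfolding 3 by (simp add: Phi_powr norm_diff_reflect_diff e add.commute)
  next
    case 4
    define n where "n = CARD('n) - 4"
    have n: "0 < n" "k + real CARD('n) / 2 - 1 = k + 1 + real n / 2"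
      using 4 by (simp_all add: n_def of_nat_diff diff_divide_distrib)
    have sqrt_min: "sqrt (min ((norm u)\<^sup>2) ((norm v)\<^sup>2)) = min (norm u) (norm v)" for u v :: "real ^ 'n"
      by (auto simp: min_def power2_le_iff_abs_le)
    show ?thesis
      using comparable[of "\<lambda>a b. 1 / ennreal (max a b powr k * a * sqrt (min a b) ^ n)"]
        newton_integral_dim_ge5[OF assms(2) n(1)] 4
      unfolding n(2) by (simp add: Phi_powr sqrt_min n_def)
  qed
qed

end
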